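(* Let $(\Sigma,\mathscr{C},(-)^\sigma,(-)^+)$ be a canonicity framework, and let $\mathcal{S}\subseteq\Sigma$ be a class closed under ultraproducts. Then the variety of algebras generated by $\mathcal{S}^+=\{P^+:P\in\mathcal{S}\}$ (i.e. $\mathbf{HSP}\,\mathcal{S}^+$) is closed under the operation $(-)^\sigma$.
   Context: Write $\mathbb{A}\rightarrowtail\mathbb{B}$ if there is an injective homomorphism from $\mathbb{A}$ to $\mathbb{B}$, and $\mathbb{A}\twoheadrightarrow\mathbb{B}$ if there is a surjective one. A canonicity framework consists of: a class $\Sigma$ of structures (of some type, for which ultraproducts $\prod_U P_i$ are defined) that is closed under ultraproducts; a variety $\mathscr{C}$ of algebras of a given signature; an operation $(-)^\sigma\colon\mathscr{C}\to\mathscr{C}$; and an operation $(-)^+\colon\Sigma\to\mathscr{C}$; such that for all $\mathbb{A},\mathbb{B}\in\mathscr{C}$, all indexed families $\{P_i:i\in I\}\subseteq\Sigma$ and all $P\in\Sigma$: (A1) if $\mathbb{A}\rightarrowtail\mathbb{B}$ then $\mathbb{A}^\sigma\rightarrowtail\mathbb{B}^\sigma$, and if $\mathbb{A}\twoheadrightarrow\mathbb{B}$ then $\mathbb{A}^\sigma\twoheadrightarrow\mathbb{B}^\sigma$; (A2) $\prod_U(P_i^+)\rightarrowtail(\prod_U P_i)^+$ for every ultrafilter $U$ on $I$; (A3) there exists an ultrafilter $U$ with $(P^+)^\sigma\rightarrowtail(P^U)^+$, where $P^U$ is the ultrapower; (A4) $(\prod_I P_i^+)^\sigma\rightarrowtail\prod_{U\in\beta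 I}(\prod_U P_i^+)^\sigma$, where $\beta I$ is the set of ultrafilters on $I$. *)

theory Defs
  imports Main "HOL-Library.FuncSet"
begin

section \<open>A universe of sets\<close>

text \<open>
  The theorem speaks of proper classes of algebras and structures that are closed under products and
  ultraproducts over arbitrary index sets. No HOL type is closed under these, so the ambient set
  theory is made explicit: the type variable \<open>'v\<close> ranges over (second-order) universes of sets.
  The sets of the informal theory are the small subsets of \<open>'v\<close>; its classes are
  arbitrary HOL sets of objects built from small sets. The axiom of infinity is not imposed, so
  besides the universes of ZFC the hereditarily finite sets also form a model.
\<close>

class set_universe =
  fixes elts :: "'a \<Rightarrow> 'a set"
  assumes extensionality: "elts x = elts y \<Longrightarrow> x = y"
    and foundation: "wf {(x, y). x \<in> elts y}"
    and separation: "A \<subseteq> elts x \<Longrightarrow> A \<in> range elts"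
    and pairing: "{x, y} \<in> range elts"
    and union: "(\<Union>y\<in>elts x. elts y) \<in> range elts"
    and powerset: "{y. elts y \<subseteq> elts x} \<in> range elts"
    and replacement: "f ` elts x \<in> range elts"

definition small :: "'v::set_universe set \<Rightarrow> bool" where
  "small A \<longleftrightarrow> A \<in> range elts"

definition code :: "'v::set_universe set \<Rightarrow> 'v" where
  "code A = (THE x. elts x = A)"

definition vpair :: "'v::set_universe \<Rightarrow> 'v \<Rightarrow> 'v" where
  "vpair x y = code {code {x}, code {x, y}}"

definition vlam :: "'v::set_universe set \<Rightarrow> ('v \<Rightarrow> 'v) \<Rightarrow> 'v" where
  "vlam I f = code ((\<lambda>i. vpair i (f i)) ` I)"

definition vapp :: "'v::set_universe \<Rightarrow> 'v \<Rightarrow> 'v" where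
  "vapp g i = (THE y. vpair i y \<in> elts g)"

definition vprod :: "'v::set_universe set \<Rightarrow> ('v \<Rightarrow> 'v set) \<Rightarrow> 'v set" where
  "vprod I X = vlam I ` Pi I X"


section \<open>Ultrafilters and ultraproducts of sets\<close>

definition ultrafilter_on :: "'a set \<Rightarrow> 'a set set \<Rightarrow> bool" where
  "ultrafilter_on I U \<longleftrightarrow>
     U \<subseteq> Pow I \<and> I \<in> U \<and> {} \<notin> U \<and>
     (\<forall>X\<in>U. \<forall>Y\<in>U. X \<inter> Y \<in> U) \<and>
     (\<forall>X\<in>U. \<forall>Y. X \<subseteq> Y \<and> Y \<subseteq> I \<longrightarrow> Y \<in> U) \<and>
     (\<forall>X. X \<subseteq> I \<longrightarrow> X \<in> U \<or> I - X \<in> U)"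

text \<open>The set of ultrafilters on \<open>I\<close>, each given by its code, so that it can serve as an index set.\<close>

definition beta :: "'v::set_universe set \<Rightarrow> 'v set" where
  "beta I = {u. ultrafilter_on I (elts ` elts u)}"

definition uclass ::
  "'v::set_universe set \<Rightarrow> 'v set set \<Rightarrow> ('v \<Rightarrow> 'v set) \<Rightarrow> 'v \<Rightarrow> 'v" where
  "uclass I U X g = code {h \<in> vprod I X. {i \<in> I. vapp h i = vapp g i} \<in> U}"

definition uprod_set ::
  "'v::set_universe set \<Rightarrow> 'v set set \<Rightarrow> ('v \<Rightarrow> 'v set) \<Rightarrow> 'v set" where
  "uprod_set I U X = uclass I U X ` vprod I X"

text \<open>The \<open>i\<close>-th coordinate of a chosen representative of the class \<open>c\<close>.\<close>

definition urep :: "'v::set_universe \<Rightarrow> 'v \<Rightarrow> 'v" where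
  "urep c i = vapp (SOME g. g \<in> elts c) i"


section \<open>Algebras\<close>

text \<open>
  A signature is a partial map \<open>ar\<close> from symbols to arities; its domain is the set of operation
  symbols. Operations are \<open>undefined\<close> outside their domain, so that
  equality of records is equality of algebras.
\<close>

record ('f, 'v) alg =
  carrier :: "'v set"
  oper :: "'f \<Rightarrow> 'v list \<Rightarrow> 'v"

definition args :: "('f \<Rightarrow> nat option) \<Rightarrow> 'f \<Rightarrow> 'v set \<Rightarrow> 'v list set" where
  "args ar f X = {xs. ar f = Some (length xs) \<and> set xs \<subseteq> X}"

definition algebra :: "('f \<Rightarrow> nat option) \<Rightarrow> ('f, 'v::set_universe) alg \<Rightarrow> bool" where
  "algebra ar A \<longleftrightarrow>
     small (carrier A) \<and> carrier A \<noteq> {} \<and>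
     (\<forall>f. \<forall>xs \<in> args ar f (carrier A). oper A f xs \<in> carrier A) \<and>
     (\<forall>f xs. xs \<notin> args ar f (carrier A) \<longrightarrow> oper A f xs = undefined)"

definition hom ::
  "('f \<Rightarrow> nat option) \<Rightarrow> ('f, 'v) alg \<Rightarrow> ('f, 'v) alg \<Rightarrow> ('v \<Rightarrow> 'v) \<Rightarrow> bool" where
  "hom ar A B h \<longleftrightarrow>
     h \<in> carrier A \<rightarrow> carrier B \<and>
     (\<forall>f. \<forall>xs \<in> args ar f (carrier A). h (oper A f xs) = oper B f (map h xs))"

definition embeds :: "('f \<Rightarrow> nat option) \<Rightarrow> ('f, 'v) alg \<Rightarrow> ('f, 'v) alg \<Rightarrow> bool" where
  "embeds ar A B \<longleftrightarrow> (\<exists>h. hom ar A B h \<and> inj_on h (carrier A))"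

definition maps_onto :: "('f \<Rightarrow> nat option) \<Rightarrow> ('f, 'v) alg \<Rightarrow> ('f, 'v) alg \<Rightarrow> bool" where
  "maps_onto ar A B \<longleftrightarrow> (\<exists>h. hom ar A B h \<and> h ` carrier A = carrier B)"

definition subalgebra ::
  "('f \<Rightarrow> nat option) \<Rightarrow> ('f, 'v::set_universe) alg \<Rightarrow> ('f, 'v) alg \<Rightarrow> bool" where
  "subalgebra ar B A \<longleftrightarrow>
     algebra ar B \<and> carrier B \<subseteq> carrier A \<and>
     (\<forall>f. \<forall>xs \<in> args ar f (carrier B). oper B f xs = oper A f xs)"

definition alg_prod ::
  "('f \<Rightarrow> nat option) \<Rightarrow> 'v::set_universe set \<Rightarrow> ('v \<Rightarrow> ('f, 'v) alg) \<Rightarrow> ('f, 'v) alg" where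
  "alg_prod ar I A =
     (let X = vprod I (\<lambda>i. carrier (A i)) in
      \<lparr>carrier = X,
       oper = (\<lambda>f xs. if xs \<in> args ar f X
         then vlam I (\<lambda>i. oper (A i) f (map (\<lambda>x. vapp x i) xs)) else undefined)\<rparr>)"

definition alg_uprod ::
  "('f \<Rightarrow> nat option) \<Rightarrow> 'v::set_universe set \<Rightarrow> 'v set set \<Rightarrow> ('v \<Rightarrow> ('f, 'v) alg) \<Rightarrow> ('f, 'v) alg"
where
  "alg_uprod ar I U A =
     (let X = uprod_set I U (\<lambda>i. carrier (A i)) in
      \<lparr>carrier = X,
       oper = (\<lambda>f cs. if cs \<in> args ar f X
         then uclass I U (\<lambda>i. carrier (A i))
                (vlam I (\<lambda>i. oper (A i) f (map (\<lambda>c. urep c i) cs)))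
         else undefined)\<rparr>)"

definition H_op ::
  "('f \<Rightarrow> nat option) \<Rightarrow> ('f, 'v::set_universe) alg set \<Rightarrow> ('f, 'v) alg set" where
  "H_op ar K = {B. algebra ar B \<and> (\<exists>A\<in>K. maps_onto ar A B)}"

definition S_op ::
  "('f \<Rightarrow> nat option) \<Rightarrow> ('f, 'v::set_universe) alg set \<Rightarrow> ('f, 'v) alg set" where
  "S_op ar K = {B. \<exists>A\<in>K. subalgebra ar B A}"

definition P_op ::
  "('f \<Rightarrow> nat option) \<Rightarrow> ('f, 'v::set_universe) alg set \<Rightarrow> ('f, 'v) alg set" where
  "P_op ar K = {alg_prod ar I A | I A. small I \<and> (\<forall>i\<in>I. A i \<in> K)}"

definition HSP ::
  "('f \<Rightarrow> nat option) \<Rightarrow> ('f, 'v::set_universe) alg set \<Rightarrow> ('f, 'v) alg set" where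
  "HSP ar K = H_op ar (S_op ar (P_op ar K))"

definition variety :: "('f \<Rightarrow> nat option) \<Rightarrow> ('f, 'v::set_universe) alg set \<Rightarrow> bool" where
  "variety ar K \<longleftrightarrow>
     (\<forall>A\<in>K. algebra ar A) \<and> H_op ar K \<subseteq> K \<and> S_op ar K \<subseteq> K \<and> P_op ar K \<subseteq> K"

definition variety_generated ::
  "('f \<Rightarrow> nat option) \<Rightarrow> ('f, 'v::set_universe) alg set \<Rightarrow> ('f, 'v) alg set" where
  "variety_generated ar K = \<Inter>{V. variety ar V \<and> K \<subseteq> V}"


section \<open>Structures\<close>

text \<open>
  Many-sorted first-order structures, with operations and relations. The similarity type assigns
  argument sorts and a result sort to each operation symbol, and argument sorts to each relation
  symbol. Every type \<open>'s\<close> of sorts is allowed.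
\<close>

record ('s, 'g, 'r) sim_type =
  fun_type :: "'g \<Rightarrow> ('s list \<times> 's) option"
  rel_type :: "'r \<Rightarrow> 's list option"

record ('s, 'g, 'r, 'v) struct =
  dom_of :: "'s \<Rightarrow> 'v set"
  fun_of :: "'g \<Rightarrow> 'v list \<Rightarrow> 'v"
  rel_of :: "'r \<Rightarrow> 'v list set"

definition sorted_args :: "('s \<Rightarrow> 'v set) \<Rightarrow> 's list \<Rightarrow> 'v list set" where
  "sorted_args D ss = {xs. list_all2 (\<lambda>x s. x \<in> D s) xs ss}"

definition structure_of ::
  "('s, 'g, 'r) sim_type \<Rightarrow> ('s, 'g, 'r, 'v::set_universe) struct \<Rightarrow> bool" where
  "structure_of \<tau> P \<longleftrightarrow>
     (\<forall>s. small (dom_of P s) \<and> dom_of P s \<noteq> {}) \<and>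
     (\<forall>g. case fun_type \<tau> g of
        None \<Rightarrow> \<forall>xs. fun_of P g xs = undefined
      | Some (ss, s) \<Rightarrow>
          (\<forall>xs \<in> sorted_args (dom_of P) ss. fun_of P g xs \<in> dom_of P s) \<and>
          (\<forall>xs. xs \<notin> sorted_args (dom_of P) ss \<longrightarrow> fun_of P g xs = undefined)) \<and>
     (\<forall>r. case rel_type \<tau> r of
        None \<Rightarrow> rel_of P r = {}
      | Some ss \<Rightarrow> rel_of P r \<subseteq> sorted_args (dom_of P) ss)"

definition struct_uprod ::
  "('s, 'g, 'r) sim_type \<Rightarrow> 'v::set_universe set \<Rightarrow> 'v set set \<Rightarrow>
   ('v \<Rightarrow> ('s, 'g, 'r, 'v) struct) \<Rightarrow> ('s, 'g, 'r, 'v) struct" where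
  "struct_uprod \<tau> I U P =
     (let D = (\<lambda>s. uprod_set I U (\<lambda>i. dom_of (P i) s)) in
      \<lparr>dom_of = D,
       fun_of = (\<lambda>g cs. case fun_type \<tau> g of
           None \<Rightarrow> undefined
         | Some (ss, s) \<Rightarrow>
             if cs \<in> sorted_args D ss
             then uclass I U (\<lambda>i. dom_of (P i) s)
                    (vlam I (\<lambda>i. fun_of (P i) g (map (\<lambda>c. urep c i) cs)))
             else undefined),
       rel_of = (\<lambda>r. case rel_type \<tau> r of
           None \<Rightarrow> {}
         | Some ss \<Rightarrow>
             {cs \<in> sorted_args D ss. {i \<in> I. map (\<lambda>c. urep c i) cs \<in> rel_of (P i) r} \<in> U})\<rparr>)"

definition uprod_closed ::
  "('s, 'g, 'r) sim_type \<Rightarrow> ('s, 'g, 'r, 'v::set_universe) struct set \<Rightarrow> bool" where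
  "uprod_closed \<tau> K \<longleftrightarrow>
     (\<forall>I U P. small I \<and> ultrafilter_on I U \<and> (\<forall>i\<in>I. P i \<in> K) \<longrightarrow> struct_uprod \<tau> I U P \<in> K)"


section \<open>Canonicity frameworks\<close>

text \<open>
  \<open>sig\<close> and \<open>pl\<close> are the operations \<open>(-)\<^sup>\<sigma>\<close> on \<open>C\<close> and \<open>(-)\<^sup>+\<close> on \<open>\<Sigma>\<close>;
  nothing is assumed about their values elsewhere.
\<close>

locale canonicity_framework =
  fixes \<tau> :: "('s, 'g, 'r) sim_type"
    and ar :: "'f \<Rightarrow> nat option"
    and \<Sigma> :: "('s, 'g, 'r, 'v::set_universe) struct set"
    and C :: "('f, 'v) alg set"
    and sig :: "('f, 'v) alg \<Rightarrow> ('f, 'v) alg"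
    and pl :: "('s, 'g, 'r, 'v) struct \<Rightarrow> ('f, 'v) alg"
  assumes structures: "P \<in> \<Sigma> \<Longrightarrow> structure_of \<tau> P"
    and uprod_closed: "uprod_closed \<tau> \<Sigma>"
    and variety: "variety ar C"
    and sig_closed: "A \<in> C \<Longrightarrow> sig A \<in> C"
    and pl_closed: "P \<in> \<Sigma> \<Longrightarrow> pl P \<in> C"
    and A1_embeds: "A \<in> C \<Longrightarrow> B \<in> C \<Longrightarrow> embeds ar A B \<Longrightarrow> embeds ar (sig A) (sig B)"
    and A1_onto: "A \<in> C \<Longrightarrow> B \<in> C \<Longrightarrow> maps_onto ar A B \<Longrightarrow> maps_onto ar (sig A) (sig B)"
    and A2: "small I \<Longrightarrow> (\<And>i. i \<in> I \<Longrightarrow> Q i \<in> \<Sigma>) \<Longrightarrow> ultrafilter_on I U \<Longrightarrow>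
      embeds ar (alg_uprod ar I U (\<lambda>i. pl (Q i))) (pl (struct_uprod \<tau> I U Q))"
    and A3: "P \<in> \<Sigma> \<Longrightarrow> \<exists>I U. small I \<and> ultrafilter_on I U \<and>
      embeds ar (sig (pl P)) (pl (struct_uprod \<tau> I U (\<lambda>i. P)))"
    and A4: "small I \<Longrightarrow> (\<And>i. i \<in> I \<Longrightarrow> Q i \<in> \<Sigma>) \<Longrightarrow>
      embeds ar (sig (alg_prod ar I (\<lambda>i. pl (Q i))))
        (alg_prod ar (beta I) (\<lambda>u. sig (alg_uprod ar I (elts ` elts u) (\<lambda>i. pl (Q i)))))"

end

theory Submission
  imports Defs
begin

text \<open>
  An algebra \<open>A\<close> of the variety is an image of some \<open>D\<close> embedded in a product \<open>\<Prod>\<^sub>I P\<^sub>i\<^sup>+\<close>, so by (A1)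
  it suffices to treat that product. By (A4) its \<open>\<sigma>\<close>-extension embeds into the product
  over \<open>u \<in> \<beta>I\<close> of the algebras \<open>(\<Prod>\<^sub>u P\<^sub>i\<^sup>+)\<^sup>\<sigma>\<close>. Writing \<open>P\<^sub>u = \<Prod>\<^sub>u P\<^sub>i\<close>, which lies in \<open>S\<close>, each of these
  embeds into \<open>(P\<^sub>u\<^sup>+)\<^sup>\<sigma>\<close> by (A2) and (A1), hence into \<open>Q\<^sup>+\<close> for an ultrapower \<open>Q \<in> S\<close> of
  \<open>P\<^sub>u\<close> by (A3).
\<close>

section \<open>Small sets\<close>

lemma smallE:
  assumes "small A"
  obtains x where "A = elts x"
  using assms by (auto simp: small_def)

lemma small_elts [simp]: "small (elts x)"
  by (simp add: small_def)

lemma code_elts [simp]: "code (elts x) = x"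
  unfolding code_def by (rule the_equality) (auto intro: extensionality)

lemma elts_code [simp]: "small A \<Longrightarrow> elts (code A) = A"
  by (auto simp: small_def)

lemma code_eq_iff: "small A \<Longrightarrow> small B \<Longrightarrow> code A = code B \<longleftrightarrow> A = B"
  by (metis elts_code)

lemma small_subset: "small B \<Longrightarrow> A \<subseteq> B \<Longrightarrow> small A"
  unfolding small_def using separation by blast

lemma small_image:
  fixes f :: "'v::set_universe \<Rightarrow> 'v"
  shows "small A \<Longrightarrow> small (f ` A)"
  by (elim smallE) (simp only: small_def replacement)

lemma small_pair [simp]: "small {x, y}"
  by (simp add: pairing small_def)

lemma small_singleton [simp]: "small {x}"
  using small_pair[of x x] by simp

lemma small_UN:
  fixes X :: "'v::set_universe \<Rightarrow> 'v set"
  assumes "small I" and "\<And>i. i \<in> I \<Longrightarrow> small (X i)"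
  shows "small (\<Union>i\<in>I. X i)"
proof -
  \<comment> \<open>The union axiom needs the members of a single object of the universe, so the
    sets \<open>X i\<close> are coded and their codes collected by replacement.\<close>
  have "(\<Union>i\<in>I. X i) = (\<Union>y\<in>elts (code ((\<lambda>i. code (X i)) ` I)). elts y)"
    using assms by (simp add: small_image)
  then show ?thesis
    by (simp only: small_def union)
qed

lemma small_powerset: "small A \<Longrightarrow> small {y. elts y \<subseteq> A}"
  by (elim smallE) (simp only: small_def powerset)

section \<open>Kuratowski pairs, coded functions and dependent products\<close>

lemma vpair_eq_iff [simp]: "vpair a b = vpair c d \<longleftrightarrow> a = c \<and> b = d"
  by (auto simp: vpair_def code_eq_iff doubleton_eq_iff)

lemma vapp_vlam [simp]: "small I \<Longrightarrow> i \<in> I \<Longrightarrow> vapp (vlam I f) i = f i"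
  unfolding vapp_def vlam_def by (rule the_equality) (auto simp: small_image)

lemma vlam_cong: "(\<And>i. i \<in> I \<Longrightarrow> f i = g i) \<Longrightarrow> vlam I f = vlam I g"
  unfolding vlam_def by (rule arg_cong[where f = code]) auto

lemma vlam_in_vprod: "(\<And>i. i \<in> I \<Longrightarrow> f i \<in> X i) \<Longrightarrow> vlam I f \<in> vprod I X"
  by (auto simp: vprod_def)

lemma vapp_in: "small I \<Longrightarrow> g \<in> vprod I X \<Longrightarrow> i \<in> I \<Longrightarrow> vapp g i \<in> X i"
  by (auto simp: vprod_def)

lemma vlam_vapp: "small I \<Longrightarrow> g \<in> vprod I X \<Longrightarrow> vlam I (vapp g) = g"
  by (auto simp: vprod_def intro!: vlam_cong)

text \<open>An element of a product is the code of its own graph over \<open>I\<close>, so its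
  values on \<open>I\<close> determine it; the families \<open>X\<close> and \<open>Y\<close> may
  therefore differ.\<close>

lemma vprod_ext:
  "small I \<Longrightarrow> g \<in> vprod I X \<Longrightarrow> h \<in> vprod I Y \<Longrightarrow> (\<And>i. i \<in> I \<Longrightarrow> vapp g i = vapp h i) \<Longrightarrow> g = h"
  using vlam_cong[of I "vapp g" "vapp h"] by (simp add: vlam_vapp)

lemma vprod_nonempty:
  assumes "\<And>i. i \<in> I \<Longrightarrow> X i \<noteq> {}"
  shows "vprod I X \<noteq> {}"
  using vlam_in_vprod[of I "\<lambda>i. SOME x. x \<in> X i" X] assms by (auto simp: some_in_eq)

lemma small_vprod:
  assumes "small I" and "\<And>i. i \<in> I \<Longrightarrow> small (X i)"
  shows "small (vprod I X)"
proof (rule small_subset)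
  \<comment> \<open>An element of the product is coded by its graph, a subset of the disjoint union
    of the \<open>X i\<close>; so the product lies in the power set of that union.\<close>
  show "small {y. elts y \<subseteq> (\<Union>i\<in>I. vpair i ` X i)}"
    by (intro small_powerset small_UN small_image assms)
  show "vprod I X \<subseteq> {y. elts y \<subseteq> (\<Union>i\<in>I. vpair i ` X i)}"
    using assms(1) by (auto simp: vprod_def vlam_def small_image image_iff Pi_iff)
qed

lemma small_beta:
  assumes "small I"
  shows "small (beta I)"
proof (rule small_subset)
  \<comment> \<open>A member of \<open>beta I\<close> is a code whose elements are codes of subsets
    of \<open>I\<close>, hence a point of the double power set.\<close>
  show "small {u. elts u \<subseteq> {y. elts y \<subseteq> I}}"
    by (intro small_powerset assms)
  show "beta I \<subseteq> {u. elts u \<subseteq> {y. elts y \<subseteq> I}}"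
    by (auto simp: beta_def ultrafilter_on_def)
qed


section \<open>Homomorphisms and products\<close>

lemma map_in_args: "h \<in> X \<rightarrow> Y \<Longrightarrow> xs \<in> args ar f X \<Longrightarrow> map h xs \<in> args ar f Y"
  by (auto simp: args_def)

lemma args_image:
  assumes "ys \<in> args ar f (h ` X)"
  obtains xs where "xs \<in> args ar f X" "ys = map h xs"
proof -
  have "set ys \<subseteq> h ` X" using assms by (simp add: args_def)
  then have "ys \<in> lists (h ` X)" by (simp add: in_lists_conv_set subset_iff)
  then obtain xs where "xs \<in> lists X" "ys = map h xs"
    by (auto simp: lists_image)
  with assms have "xs \<in> args ar f X" by (auto simp: args_def)
  with \<open>ys = map h xs\<close> that show thesis by blast
qed

lemma hom_comp:
  assumes "hom ar A B h" "hom ar B D k"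
  shows "hom ar A D (\<lambda>x. k (h x))"
  using assms map_in_args[of h "carrier A" "carrier B"]
  by (fastforce simp: hom_def comp_def)

lemma embeds_trans:
  assumes "embeds ar A B" "embeds ar B D"
  shows "embeds ar A D"
proof -
  from assms obtain h k where hk: "hom ar A B h" "inj_on h (carrier A)"
    "hom ar B D k" "inj_on k (carrier B)"
    by (auto simp: embeds_def)
  then have "inj_on (\<lambda>x. k (h x)) (carrier A)"
    by (auto simp: hom_def Pi_iff inj_on_def)
  with hom_comp[OF hk(1,3)] show ?thesis unfolding embeds_def by blast
qed

lemma maps_onto_trans:
  assumes "maps_onto ar A B" "maps_onto ar B D"
  shows "maps_onto ar A D"
proof -
  from assms obtain h k where
    "hom ar A B h" "h ` carrier A = carrier B" "hom ar B D k" "k ` carrier B = carrier D"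
    by (auto simp: maps_onto_def)
  then have "hom ar A D (\<lambda>x. k (h x))" "(\<lambda>x. k (h x)) ` carrier A = carrier D"
    using image_image[of k h "carrier A"] by (simp_all add: hom_comp)
  then show ?thesis unfolding maps_onto_def by blast
qed

lemma subalgebra_embeds: "subalgebra ar B A \<Longrightarrow> embeds ar B A"
  unfolding subalgebra_def embeds_def hom_def
  by (intro exI[of _ "\<lambda>x. x"]) auto

text \<open>Argument lists over the image lift to \<open>A\<close>, which gives closure under the
  operations, and replacement gives smallness. Being \<open>undefined\<close> off the domain is the
  one clause of \<open>algebra\<close> that a homomorphism cannot supply, hence the separate
  hypothesis.\<close>

lemma algebra_image:
  assumes A: "algebra ar A" and h: "hom ar A B h" "h ` carrier A = carrier B"
    and undef: "\<And>f xs. xs \<notin> args ar f (carrier B) \<Longrightarrow> oper B f xs = undefined"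
  shows "algebra ar B"
proof -
  have "oper B f ys \<in> carrier B" if "ys \<in> args ar f (carrier B)" for f ys
  proof -
    from that[folded h(2)] obtain xs where "xs \<in> args ar f (carrier A)" "ys = map h xs"
      by (rule args_image)
    moreover from this A have "h (oper A f xs) \<in> carrier B"
      unfolding h(2)[symmetric] by (simp add: algebra_def)
    ultimately show ?thesis using h(1) by (simp add: hom_def)
  qed
  moreover have "small (carrier B)" "carrier B \<noteq> {}"
    using A unfolding h(2)[symmetric] by (auto simp: algebra_def small_image)
  ultimately show ?thesis using undef unfolding algebra_def by blast
qed

text \<open>\<open>S_op\<close> asks for a literal inclusion of carriers, while the framework axioms
  give only injections. The image of the injection is a literal subalgebra, and the inverse map is a
  homomorphism from it onto \<open>B\<close>, so an embedding costs one \<open>S_op\<close> and one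
  \<open>H_op\<close>.\<close>

lemma embeds_image:
  assumes B: "algebra ar B" and "embeds ar B A"
  obtains D where "subalgebra ar D A" "maps_onto ar D B"
proof -
  from assms(2) obtain h where h: "hom ar B A h" and inj: "inj_on h (carrier B)"
    by (auto simp: embeds_def)
  define D where "D = \<lparr>carrier = h ` carrier B,
    oper = (\<lambda>f xs. if xs \<in> args ar f (h ` carrier B) then oper A f xs else undefined)\<rparr>"
  have hD: "hom ar B D h"
    using h map_in_args[of h "carrier B" "h ` carrier B" _ ar] by (auto simp: hom_def D_def)
  have "algebra ar D"
    by (rule algebra_image[OF B hD]) (simp_all add: D_def)
  then have "subalgebra ar D A"
    using h by (auto simp: subalgebra_def D_def hom_def)
  moreover have "hom ar D B (inv_into (carrier B) h)"
    unfolding hom_def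
  proof (intro conjI allI ballI)
    show "inv_into (carrier B) h \<in> carrier D \<rightarrow> carrier B"
      by (auto simp: D_def inv_into_into)
    fix f ys assume "ys \<in> args ar f (carrier D)"
    then obtain xs where xs: "xs \<in> args ar f (carrier B)" "ys = map h xs"
      by (auto simp: D_def elim: args_image)
    \<comment> \<open>The inverse cancels \<open>h\<close> along the whole list, because
      \<open>xs\<close> stays inside the carrier, where \<open>h\<close> is injective.\<close>
    have "map (inv_into (carrier B) h) ys = map (\<lambda>x. x) xs"
      unfolding xs(2) map_map
      by (rule map_cong) (use xs(1) inj in \<open>auto simp: args_def\<close>)
    moreover have "oper D f ys = h (oper B f xs)"
      using hD xs by (simp add: hom_def)
    moreover have "oper B f xs \<in> carrier B"
      using B xs by (simp add: algebra_def)
    ultimately show "inv_into (carrier B) h (oper D f ys) = oper B f (map (inv_into (carrier B) h) ys)"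
      using inj by simp
  qed
  moreover have "inv_into (carrier B) h ` carrier D = carrier B"
    using inj by (simp add: D_def)
  ultimately show thesis using that unfolding maps_onto_def by blast
qed

section \<open>Direct products of algebras\<close>

lemma carrier_alg_prod [simp]: "carrier (alg_prod ar I A) = vprod I (\<lambda>i. carrier (A i))"
  by (simp add: alg_prod_def Let_def)

lemma oper_alg_prod:
  "xs \<in> args ar f (vprod I (\<lambda>i. carrier (A i))) \<Longrightarrow>
    oper (alg_prod ar I A) f xs = vlam I (\<lambda>i. oper (A i) f (map (\<lambda>x. vapp x i) xs))"
  by (simp add: alg_prod_def Let_def)

text \<open>Neither the carrier nor the operations look at the family outside \<open>I\<close>. This
  allows a family to be replaced by one known to agree with it only on the index set.\<close>

lemma alg_prod_cong:
  assumes "\<And>i. i \<in> I \<Longrightarrow> A i = B i"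
  shows "alg_prod ar I A = alg_prod ar I B"
proof -
  have "vprod I (\<lambda>i. carrier (A i)) = vprod I (\<lambda>i. carrier (B i))"
    unfolding vprod_def by (rule arg_cong[where f = "\<lambda>F. vlam I ` F"]) (simp add: Pi_def assms)
  moreover have "vlam I (\<lambda>i. oper (A i) f (map (\<lambda>x. vapp x i) xs))
      = vlam I (\<lambda>i. oper (B i) f (map (\<lambda>x. vapp x i) xs))" for f xs
    using assms by (intro vlam_cong) simp
  ultimately show ?thesis by (simp add: alg_prod_def Let_def cong: if_cong)
qed

lemma algebra_alg_prod:
  assumes "small I" and A: "\<forall>i\<in>I. algebra ar (A i)"
  shows "algebra ar (alg_prod ar I A)"
proof -
  let ?X = "vprod I (\<lambda>i. carrier (A i))"
  have "oper (alg_prod ar I A) f xs \<in> ?X" if "xs \<in> args ar f ?X" for f xs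
    unfolding oper_alg_prod[OF that]
  proof (rule vlam_in_vprod)
    fix i assume i: "i \<in> I"
    have "map (\<lambda>x. vapp x i) xs \<in> args ar f (carrier (A i))"
      by (rule map_in_args[OF _ that]) (use assms(1) i in \<open>auto intro: vapp_in\<close>)
    with A i show "oper (A i) f (map (\<lambda>x. vapp x i) xs) \<in> carrier (A i)"
      by (simp add: algebra_def)
  qed
  moreover have "small ?X" "?X \<noteq> {}"
    using A by (auto simp: algebra_def intro!: small_vprod vprod_nonempty assms(1))
  moreover have "oper (alg_prod ar I A) f xs = undefined" if "xs \<notin> args ar f ?X" for f xs
    using that by (simp add: alg_prod_def Let_def)
  ultimately show ?thesis by (simp add: algebra_def)
qed

lemma hom_vapp:
  assumes "small I" "i \<in> I"
  shows "hom ar (alg_prod ar I A) (A i) (\<lambda>x. vapp x i)"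
  using assms by (auto simp: hom_def oper_alg_prod intro: vapp_in)

text \<open>The universal property of the product; together with the projections
  \<open>hom_vapp\<close> it yields the maps into products constructed below.\<close>

lemma hom_vlam:
  assumes J: "small J" and h: "\<And>j. j \<in> J \<Longrightarrow> hom ar A (B j) (h j)"
  shows "hom ar A (alg_prod ar J B) (\<lambda>x. vlam J (\<lambda>j. h j x))"
  unfolding hom_def
proof (intro conjI allI ballI)
  show *: "(\<lambda>x. vlam J (\<lambda>j. h j x)) \<in> carrier A \<rightarrow> carrier (alg_prod ar J B)"
    using h by (auto simp: hom_def intro!: vlam_in_vprod)
  fix f xs assume xs: "xs \<in> args ar f (carrier A)"
  have "map (\<lambda>x. vlam J (\<lambda>j. h j x)) xs \<in> args ar f (vprod J (\<lambda>j. carrier (B j)))"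
    using map_in_args[OF * xs] by simp
  moreover have "h j (oper A f xs) = oper (B j) f (map (\<lambda>x. vapp (vlam J (\<lambda>j. h j x)) j) xs)"
    if "j \<in> J" for j
    using h[OF that] xs J that by (simp add: hom_def)
  ultimately show "vlam J (\<lambda>j. h j (oper A f xs)) =
      oper (alg_prod ar J B) f (map (\<lambda>x. vlam J (\<lambda>j. h j x)) xs)"
    by (auto simp: oper_alg_prod comp_def intro: vlam_cong)
qed

lemma maps_onto_alg_prod:
  assumes J: "small J" and "\<forall>j\<in>J. maps_onto ar (A j) (B j)"
  shows "maps_onto ar (alg_prod ar J A) (alg_prod ar J B)"
proof -
  from assms(2) have "\<forall>j\<in>J. \<exists>h. hom ar (A j) (B j) h \<and> h ` carrier (A j) = carrier (B j)"
    by (simp add: maps_onto_def)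
  then obtain h where h: "\<And>j. j \<in> J \<Longrightarrow> hom ar (A j) (B j) (h j)"
    and onto: "\<And>j. j \<in> J \<Longrightarrow> h j ` carrier (A j) = carrier (B j)"
    by metis
  let ?k = "\<lambda>x. vlam J (\<lambda>j. h j (vapp x j))"
  have k: "hom ar (alg_prod ar J A) (alg_prod ar J B) ?k"
    by (intro hom_vlam J hom_comp[OF hom_vapp] h)
  have "y \<in> ?k ` carrier (alg_prod ar J A)" if y: "y \<in> carrier (alg_prod ar J B)" for y
  proof
    \<comment> \<open>A preimage of \<open>y\<close> is chosen in each coordinate
      separately.\<close>
    let ?x = "vlam J (\<lambda>j. inv_into (carrier (A j)) (h j) (vapp y j))"
    have *: "vapp y j \<in> h j ` carrier (A j)" if "j \<in> J" for j
      using that y J vapp_in[of J y "\<lambda>j. carrier (B j)" j] by (simp add: onto)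
    show "?x \<in> carrier (alg_prod ar J A)"
      using * by (auto intro!: vlam_in_vprod inv_into_into)
    have "?k ?x = vlam J (vapp y)"
      using * J by (intro vlam_cong) (simp add: f_inv_into_f)
    then show "y = ?k ?x" using y J by (simp add: vlam_vapp)
  qed
  moreover have "?k ` carrier (alg_prod ar J A) \<subseteq> carrier (alg_prod ar J B)"
    using k by (auto simp: hom_def)
  ultimately have "?k ` carrier (alg_prod ar J A) = carrier (alg_prod ar J B)" by blast
  with k show ?thesis unfolding maps_onto_def by blast
qed


section \<open>Ultraproducts of algebras\<close>

lemma ultrafilter_on_mono: "ultrafilter_on I U \<Longrightarrow> X \<in> U \<Longrightarrow> X \<subseteq> Y \<Longrightarrow> Y \<subseteq> I \<Longrightarrow> Y \<in> U"
  unfolding ultrafilter_on_def by blast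

lemma ultrafilter_on_Int: "ultrafilter_on I U \<Longrightarrow> X \<in> U \<Longrightarrow> Y \<in> U \<Longrightarrow> X \<inter> Y \<in> U"
  unfolding ultrafilter_on_def by blast

text \<open>Operations are finitary, so only finitely many members of \<open>U\<close> have to be
  intersected, one for each argument.\<close>

lemma ultrafilter_on_list_all:
  assumes U: "ultrafilter_on I U" and "\<And>x. x \<in> set xs \<Longrightarrow> {i \<in> I. Q x i} \<in> U"
  shows "{i \<in> I. \<forall>x\<in>set xs. Q x i} \<in> U"
  using assms(2)
proof (induction xs)
  case Nil
  then show ?case using U by (simp add: ultrafilter_on_def)
next
  case (Cons a xs)
  have "{i \<in> I. \<forall>x\<in>set (a # xs). Q x i} = {i \<in> I. Q a i} \<inter> {i \<in> I. \<forall>x\<in>set xs. Q x i}"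
    by auto
  with Cons show ?case by (auto intro: ultrafilter_on_Int[OF U])
qed

text \<open>Agreement modulo \<open>U\<close> is transitive: the set where two functions agree is
  intersected with the set where \<open>g\<close> and \<open>h\<close> agree.\<close>

lemma uclass_cong:
  assumes U: "ultrafilter_on I U" and "{i \<in> I. vapp g i = vapp h i} \<in> U"
  shows "uclass I U X g = uclass I U X h"
proof -
  have "{i \<in> I. vapp k i = vapp g i} \<in> U \<longleftrightarrow> {i \<in> I. vapp k i = vapp h i} \<in> U" for k
    using ultrafilter_on_mono[OF U ultrafilter_on_Int[OF U assms(2)]]
    by (smt (verit, best) Int_iff mem_Collect_eq subsetI)
  then show ?thesis by (simp add: uclass_def)
qed

text \<open>\<open>urep\<close> reads off an arbitrarily chosen representative; the choice is a
  genuine one because the class contains \<open>g\<close> itself. Smallness lets \<open>elts\<close>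
  recover the class from its code.\<close>

lemma urep_uclass:
  assumes U: "ultrafilter_on I U" and "small (vprod I X)" and g: "g \<in> vprod I X"
  shows "{i \<in> I. urep (uclass I U X g) i = vapp g i} \<in> U"
proof -
  have *: "elts (uclass I U X g) = {h \<in> vprod I X. {i \<in> I. vapp h i = vapp g i} \<in> U}"
    unfolding uclass_def by (rule elts_code) (rule small_subset[OF assms(2)], auto)
  have "g \<in> elts (uclass I U X g)"
    unfolding * using g U by (simp add: ultrafilter_on_def)
  then have "(SOME h. h \<in> elts (uclass I U X g)) \<in> elts (uclass I U X g)"
    by (rule someI)
  then show ?thesis by (simp add: * urep_def)
qed

text \<open>The quotient map presents the ultraproduct as a homomorphic image of the product; this
  is how ultraproducts come to lie in every variety containing the factors.\<close>

lemma alg_uprod_image: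
  assumes I: "small I" and U: "ultrafilter_on I U" and A: "\<forall>i\<in>I. algebra ar (A i)"
  shows "algebra ar (alg_uprod ar I U A)"
    and "maps_onto ar (alg_prod ar I A) (alg_uprod ar I U A)"
proof -
  define X where "X = (\<lambda>i. carrier (A i))"
  let ?P = "alg_prod ar I A" and ?B = "alg_uprod ar I U A" and ?h = "uclass I U X"
  have small: "small (vprod I X)"
    using A by (intro small_vprod I) (auto simp: X_def algebra_def)
  have carr: "?h ` carrier ?P = carrier ?B"
    by (simp add: alg_uprod_def Let_def uprod_set_def X_def)
  have hom: "hom ar ?P ?B ?h"
    unfolding hom_def
  proof (intro conjI allI ballI)
    show *: "?h \<in> carrier ?P \<rightarrow> carrier ?B"
      using carr by blast
    fix f xs assume xs: "xs \<in> args ar f (carrier ?P)"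
    have "map ?h xs \<in> args ar f (uprod_set I U (\<lambda>i. carrier (A i)))"
      using map_in_args[OF * xs] by (simp add: alg_uprod_def Let_def)
    then have 1: "oper ?B f (map ?h xs) =
        ?h (vlam I (\<lambda>i. oper (A i) f (map (\<lambda>c. urep c i) (map ?h xs))))"
      by (simp add: alg_uprod_def Let_def X_def)
    have 2: "oper ?P f xs = vlam I (\<lambda>i. oper (A i) f (map (\<lambda>x. vapp x i) xs))"
      using xs by (simp add: oper_alg_prod)
    \<comment> \<open>On this set the chosen representatives have the same coordinates as the
      arguments, so the evaluations in \<open>1\<close> and \<open>2\<close> agree there and define
      the same class.\<close>
    have "{i \<in> I. \<forall>x\<in>set xs. urep (?h x) i = vapp x i} \<in> U"
      by (rule ultrafilter_on_list_all[OF U], rule urep_uclass[OF U small])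
        (use xs in \<open>auto simp: args_def X_def\<close>)
    then show "?h (oper ?P f xs) = oper ?B f (map ?h xs)"
      unfolding 1 2 using I
      by (intro uclass_cong[OF U], elim ultrafilter_on_mono[OF U])
        (auto intro!: arg_cong[where f = "oper _ f"])
  qed
  show "algebra ar ?B"
    by (rule algebra_image[OF algebra_alg_prod[OF I A] hom carr])
      (simp_all add: alg_uprod_def Let_def)
  show "maps_onto ar ?P ?B"
    using hom carr unfolding maps_onto_def by blast
qed


section \<open>Varieties\<close>

lemma variety_algebra: "variety ar V \<Longrightarrow> A \<in> V \<Longrightarrow> algebra ar A"
  by (simp add: variety_def)

lemma variety_maps_onto: "variety ar V \<Longrightarrow> A \<in> V \<Longrightarrow> maps_onto ar A B \<Longrightarrow> algebra ar B \<Longrightarrow> B \<in> V"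
  by (auto simp: variety_def H_op_def)

lemma variety_subalgebra: "variety ar V \<Longrightarrow> A \<in> V \<Longrightarrow> subalgebra ar B A \<Longrightarrow> B \<in> V"
  by (auto simp: variety_def S_op_def)

lemma variety_embeds: "variety ar V \<Longrightarrow> A \<in> V \<Longrightarrow> embeds ar B A \<Longrightarrow> algebra ar B \<Longrightarrow> B \<in> V"
  by (meson embeds_image variety_maps_onto variety_subalgebra)

lemma variety_alg_prod:
  "variety ar V \<Longrightarrow> small I \<Longrightarrow> \<forall>i\<in>I. A i \<in> V \<Longrightarrow> alg_prod ar I A \<in> V"
  unfolding variety_def P_op_def by blast

lemma variety_alg_uprod:
  assumes "variety ar V" "small I" "ultrafilter_on I U" "\<forall>i\<in>I. A i \<in> V"
  shows "alg_uprod ar I U A \<in> V"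
proof -
  have "\<forall>i\<in>I. algebra ar (A i)"
    using assms variety_algebra by blast
  from alg_uprod_image[OF assms(2,3) this] show ?thesis
    using variety_maps_onto[OF assms(1) variety_alg_prod[OF assms(1,2,4)]] by blast
qed

section \<open>The class \<open>HSP ar K\<close> as the generated variety\<close>

lemma HSP_least:
  assumes V: "variety ar V" and "K \<subseteq> V"
  shows "HSP ar K \<subseteq> V"
proof
  fix B assume "B \<in> HSP ar K"
  then obtain D I A where "algebra ar B" "maps_onto ar D B" "subalgebra ar D (alg_prod ar I A)"
    "small I" "\<forall>i\<in>I. A i \<in> K"
    by (auto simp: HSP_def H_op_def S_op_def P_op_def)
  moreover from this have "alg_prod ar I A \<in> V"
    using \<open>K \<subseteq> V\<close> by (intro variety_alg_prod[OF V]) auto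
  ultimately show "B \<in> V"
    using variety_subalgebra[OF V] variety_maps_onto[OF V] by metis
qed

text \<open>An embedding may stand for a literal subalgebra: the extra surjection onto
  \<open>D\<close> produced by \<open>embeds_image\<close> is absorbed by the one onto
  \<open>B\<close>.\<close>

lemma HSP_iff:
  "B \<in> HSP ar K \<longleftrightarrow> algebra ar B \<and> (\<exists>I A D. small I \<and> (\<forall>i\<in>I. A i \<in> K) \<and>
    algebra ar D \<and> embeds ar D (alg_prod ar I A) \<and> maps_onto ar D B)" (is "_ \<longleftrightarrow> ?R")
proof
  assume "B \<in> HSP ar K"
  then show ?R
    unfolding HSP_def H_op_def S_op_def P_op_def
    using subalgebra_embeds subalgebra_def by fast
next
  assume ?R
  then obtain I A D where B: "algebra ar B" and I: "small I" "\<forall>i\<in>I. A i \<in> K"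
    and D: "algebra ar D" "embeds ar D (alg_prod ar I A)" "maps_onto ar D B"
    by blast
  from D(1,2) obtain E where "subalgebra ar E (alg_prod ar I A)" "maps_onto ar E D"
    by (rule embeds_image)
  with B I D(3) show "B \<in> HSP ar K"
    unfolding HSP_def H_op_def S_op_def P_op_def
    by (blast intro: maps_onto_trans)
qed

text \<open>Each \<open>A\<close> embeds into the product with the single factor \<open>A\<close>,
  and \<open>HSP_iff\<close> bridges the difference between the two.\<close>

lemma HSP_superset:
  fixes K :: "('f, 'v::set_universe) alg set"
  assumes K: "\<forall>A\<in>K. algebra ar A"
  shows "K \<subseteq> HSP ar K"
proof
  fix A assume A: "A \<in> K"
  \<comment> \<open>Any object can serve as the single index.\<close>
  fix i :: 'v
  have "hom ar A (alg_prod ar {i} (\<lambda>i. A)) (\<lambda>x. vlam {i} (\<lambda>j. x))"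
    by (rule hom_vlam) (auto simp: hom_def)
  moreover have "inj_on (\<lambda>x. vlam {i} (\<lambda>j. x)) (carrier A)"
    by (rule inj_on_inverseI[where g = "\<lambda>x. vapp x i"]) simp
  ultimately have "embeds ar A (alg_prod ar {i} (\<lambda>i. A))"
    unfolding embeds_def by blast
  moreover have "maps_onto ar A A"
    unfolding maps_onto_def hom_def by (intro exI[of _ "\<lambda>x. x"]) auto
  ultimately show "A \<in> HSP ar K"
    unfolding HSP_iff using A K
    by (intro conjI exI[of _ "{i}"] exI[of _ "\<lambda>_. A"] exI[of _ A]) auto
qed

text \<open>A product of products flattens to a product over the disjoint union \<open>L\<close> of
  the inner index sets, whose elements are pairs decoded by \<open>p\<close> and
  \<open>q\<close>.\<close>

lemma embeds_prod_prod:
  assumes J: "small J" and I: "\<forall>j\<in>J. small (I j)"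
    and emb: "\<forall>j\<in>J. embeds ar (D j) (alg_prod ar (I j) (A j))"
  obtains L p q where "small L" "\<forall>l\<in>L. p l \<in> J \<and> q l \<in> I (p l)"
    "embeds ar (alg_prod ar J D) (alg_prod ar L (\<lambda>l. A (p l) (q l)))"
proof -
  define L where "L = (\<Union>j\<in>J. vpair j ` I j)"
  \<comment> \<open>The two projections of a pair; the choices are forced on pairs since
    \<open>vpair\<close> is injective.\<close>
  define p q where "p = (\<lambda>l. SOME j::'a. \<exists>i. l = vpair j i)"
    and "q = (\<lambda>l. SOME i::'a. \<exists>j. l = vpair j i)"
  have [simp]: "p (vpair j i) = j" "q (vpair j i) = i" for j i
    by (auto simp: p_def q_def)
  have L: "small L" unfolding L_def using I by (intro small_UN small_image J) blast
  have pq: "\<forall>l\<in>L. p l \<in> J \<and> q l \<in> I (p l)"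
    by (auto simp: L_def)
  from emb have "\<forall>j\<in>J. \<exists>h. hom ar (D j) (alg_prod ar (I j) (A j)) h \<and> inj_on h (carrier (D j))"
    by (simp add: embeds_def)
  then obtain e where e: "\<And>j. j \<in> J \<Longrightarrow> hom ar (D j) (alg_prod ar (I j) (A j)) (e j)"
    and inj: "\<And>j. j \<in> J \<Longrightarrow> inj_on (e j) (carrier (D j))"
    by metis
  let ?h = "\<lambda>x. vlam L (\<lambda>l. vapp (e (p l) (vapp x (p l))) (q l))"
  have "hom ar (alg_prod ar J D) (alg_prod ar L (\<lambda>l. A (p l) (q l))) ?h"
    using pq I by (intro hom_vlam L hom_comp[OF hom_comp[OF hom_vapp e] hom_vapp] J) auto
  moreover have "inj_on ?h (carrier (alg_prod ar J D))"
  proof (rule inj_onI)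
    fix x y assume x: "x \<in> carrier (alg_prod ar J D)" and y: "y \<in> carrier (alg_prod ar J D)"
      and eq: "?h x = ?h y"
    have "vapp x j = vapp y j" if j: "j \<in> J" for j
    proof -
      have xj: "vapp x j \<in> carrier (D j)" and yj: "vapp y j \<in> carrier (D j)"
        using x y J j by (auto intro: vapp_in)
      \<comment> \<open>The coordinate of \<open>?h x\<close> at \<open>vpair j i\<close> is
        coordinate \<open>i\<close> of the \<open>e j\<close>-image of coordinate \<open>j\<close>
        of \<open>x\<close>. Varying \<open>i\<close> recovers that whole image, and then
        \<open>e j\<close> is injective.\<close>
      have "vapp (e j (vapp x j)) i = vapp (e j (vapp y j)) i" if i: "i \<in> I j" for i
      proof -
        have "vpair j i \<in> L" using i j by (auto simp: L_def)
        with arg_cong[OF eq, of "\<lambda>z. vapp z (vpair j i)"] L show ?thesis by simp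
      qed
      moreover have "e j (vapp x j) \<in> vprod (I j) (\<lambda>i. carrier (A j i))"
        "e j (vapp y j) \<in> vprod (I j) (\<lambda>i. carrier (A j i))"
        using e[OF j] xj yj by (auto simp: hom_def)
      ultimately have "e j (vapp x j) = e j (vapp y j)"
        using I j vprod_ext by blast
      with inj[OF j] xj yj show ?thesis by (simp add: inj_on_eq_iff)
    qed
    with x y J show "x = y" by (auto intro: vprod_ext)
  qed
  ultimately have "embeds ar (alg_prod ar J D) (alg_prod ar L (\<lambda>l. A (p l) (q l)))"
    unfolding embeds_def by blast
  with L pq that show thesis by blast
qed

text \<open>For \<open>H_op\<close>, surjections compose. For \<open>S_op\<close>, a subalgebra of
  an image is pulled back along the surjection (SH within HS). For \<open>P_op\<close>, surjections
  and embeddings are taken coordinatewise (PH within HP, PS within SP) and the iterated product is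
  flattened.\<close>

lemma variety_HSP: "variety ar (HSP ar K)"
  unfolding variety_def
proof (intro conjI ballI subsetI)
  show "algebra ar B" if "B \<in> HSP ar K" for B
    using that by (simp add: HSP_iff)
  show "B \<in> HSP ar K" if "B \<in> H_op ar (HSP ar K)" for B
  proof -
    from that obtain E where "algebra ar B" "E \<in> HSP ar K" "maps_onto ar E B"
      by (auto simp: H_op_def)
    then show ?thesis unfolding HSP_iff by (blast intro: maps_onto_trans)
  qed
next
  fix B assume "B \<in> S_op ar (HSP ar K)"
  then obtain E where B: "subalgebra ar B E" and "E \<in> HSP ar K"
    by (auto simp: S_op_def)
  then obtain I A D where I: "small I" "\<forall>i\<in>I. A i \<in> K"
    and D: "algebra ar D" "embeds ar D (alg_prod ar I A)" "maps_onto ar D E"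
    unfolding HSP_iff by blast
  from D(3) obtain h where h: "hom ar D E h" "h ` carrier D = carrier E"
    by (auto simp: maps_onto_def)
  \<comment> \<open>The preimage of \<open>B\<close> under \<open>h\<close>: as a subalgebra of
    \<open>D\<close> it keeps the embedding into the product, and \<open>h\<close> maps it onto
    \<open>B\<close>.\<close>
  define X where "X = {x \<in> carrier D. h x \<in> carrier B}"
  define F where "F = \<lparr>carrier = X,
    oper = (\<lambda>f xs. if xs \<in> args ar f X then oper D f xs else undefined)\<rparr>"
  have algB: "algebra ar B" and BE: "carrier B \<subseteq> carrier E"
    and operB: "\<And>f xs. xs \<in> args ar f (carrier B) \<Longrightarrow> oper B f xs = oper E f xs"
    using B by (auto simp: subalgebra_def)
  have X_args: "xs \<in> args ar f (carrier D)" "map h xs \<in> args ar f (carrier B)"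
    if "xs \<in> args ar f X" for f xs
    using that by (auto simp: args_def X_def)
  have h_oper: "h (oper D f xs) = oper B f (map h xs)" if "xs \<in> args ar f X" for f xs
    using h(1) X_args[OF that] operB by (simp add: hom_def)
  have hX: "h ` X = carrier B"
    using h(2) BE by (auto simp: X_def)
  have "algebra ar F"
    unfolding algebra_def
  proof (intro conjI allI ballI impI)
    show "small (carrier F)"
      using D(1) by (auto simp: F_def X_def algebra_def intro: small_subset)
    show "carrier F \<noteq> {}"
      using hX algB by (auto simp: F_def algebra_def)
    show "oper F f xs \<in> carrier F" if "xs \<in> args ar f (carrier F)" for f xs
      using that D(1) algB X_args[of xs f] h_oper[of xs f]
      by (simp add: F_def algebra_def) (simp add: X_def)
    show "oper F f xs = undefined" if "xs \<notin> args ar f (carrier F)" for f xs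
      using that by (simp add: F_def)
  qed
  moreover from this have "subalgebra ar F D"
    by (auto simp: subalgebra_def F_def X_def)
  moreover have "hom ar F B h"
    using h_oper hX by (auto simp: hom_def F_def)
  then have "maps_onto ar F B"
    using hX unfolding maps_onto_def F_def by auto
  ultimately show "B \<in> HSP ar K"
    unfolding HSP_iff using I D(2) algB
    by (blast intro: embeds_trans subalgebra_embeds)
next
  fix P assume "P \<in> P_op ar (HSP ar K)"
  then obtain J B where P: "P = alg_prod ar J B" and J: "small J" and B: "\<forall>j\<in>J. B j \<in> HSP ar K"
    unfolding P_op_def by blast
  have algB: "\<forall>j\<in>J. algebra ar (B j)"
    using B by (simp add: HSP_iff)
  have "\<forall>j\<in>J. \<exists>I A D. small I \<and> (\<forall>i\<in>I. A i \<in> K) \<and>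
    algebra ar D \<and> embeds ar D (alg_prod ar I A) \<and> maps_onto ar D (B j)"
    using B by (simp add: HSP_iff)
  then obtain I A D where I: "\<forall>j\<in>J. small (I j)" "\<forall>j\<in>J. \<forall>i\<in>I j. A j i \<in> K"
    and D: "\<forall>j\<in>J. algebra ar (D j)"
      "\<forall>j\<in>J. embeds ar (D j) (alg_prod ar (I j) (A j))"
      "\<forall>j\<in>J. maps_onto ar (D j) (B j)"
    by metis
  obtain L p q where L: "small L" "\<forall>l\<in>L. p l \<in> J \<and> q l \<in> I (p l)"
    "embeds ar (alg_prod ar J D) (alg_prod ar L (\<lambda>l. A (p l) (q l)))"
    by (rule embeds_prod_prod[OF J I(1) D(2)])
  show "P \<in> HSP ar K"
    unfolding HSP_iff P
    using L I(2) algebra_alg_prod[OF J algB] algebra_alg_prod[OF J D(1)]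
      maps_onto_alg_prod[OF J D(3)]
    by (intro conjI exI[of _ L] exI[of _ "\<lambda>l. A (p l) (q l)"] exI[of _ "alg_prod ar J D"]) auto
qed

lemma variety_generated_eq_HSP:
  assumes K: "\<forall>A\<in>K. algebra ar A"
  shows "variety_generated ar K = HSP ar K"
proof
  show "variety_generated ar K \<subseteq> HSP ar K"
    unfolding variety_generated_def using variety_HSP HSP_superset[OF K] by (intro Inter_lower) simp
  show "HSP ar K \<subseteq> variety_generated ar K"
    unfolding variety_generated_def by (rule Inter_greatest) (simp add: HSP_least)
qed


section \<open>Canonicity\<close>

context canonicity_framework
begin

text \<open>(A1) speaks only of members of \<open>C\<close>; the ultraproduct of algebras is one
  because it is an image of a product. Closure of \<open>S\<close> enters twice, for the
  ultraproduct of the \<open>Q i\<close> and for the ultrapower supplied by (A3).\<close>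

lemma sig_alg_uprod_embeds:
  assumes "small I" "ultrafilter_on I U" and Q: "\<forall>i\<in>I. Q i \<in> S"
    and S: "S \<subseteq> \<Sigma>" "Defs.uprod_closed \<tau> S"
  shows "\<exists>P\<in>S. embeds ar (sig (alg_uprod ar I U (\<lambda>i. pl (Q i)))) (pl P)"
proof -
  let ?P = "struct_uprod \<tau> I U Q"
  have P: "?P \<in> S"
    using assms by (simp add: Defs.uprod_closed_def)
  have "embeds ar (alg_uprod ar I U (\<lambda>i. pl (Q i))) (pl ?P)"
    using assms by (intro A2) auto
  moreover have "alg_uprod ar I U (\<lambda>i. pl (Q i)) \<in> C"
    using assms pl_closed by (intro variety_alg_uprod[OF variety]) auto
  moreover have "pl ?P \<in> C"
    using P S pl_closed by blast
  ultimately have 1: "embeds ar (sig (alg_uprod ar I U (\<lambda>i. pl (Q i)))) (sig (pl ?P))"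
    by (rule A1_embeds[rotated 2])
  obtain J W where J: "small J" "ultrafilter_on J W"
    and 2: "embeds ar (sig (pl ?P)) (pl (struct_uprod \<tau> J W (\<lambda>j. ?P)))"
    using A3 P S by blast
  have "struct_uprod \<tau> J W (\<lambda>j. ?P) \<in> S"
    using J P S by (simp add: Defs.uprod_closed_def)
  with embeds_trans[OF 1 2] show ?thesis by blast
qed

lemma sig_alg_prod_in_HSP:
  assumes I: "small I" and Q: "\<forall>i\<in>I. Q i \<in> S"
    and S: "S \<subseteq> \<Sigma>" "Defs.uprod_closed \<tau> S"
  shows "sig (alg_prod ar I (\<lambda>i. pl (Q i))) \<in> HSP ar (pl ` S)"
proof -
  have K: "\<forall>A\<in>pl ` S. algebra ar A"
    using S pl_closed variety_algebra[OF variety] by blast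
  have QC: "\<forall>i\<in>I. pl (Q i) \<in> C"
    using Q S pl_closed by blast
  \<comment> \<open>The index \<open>u\<close> is only the code of an ultrafilter, so it is decoded
    before the ultraproduct is formed.\<close>
  let ?B = "\<lambda>u. sig (alg_uprod ar I (elts ` elts u) (\<lambda>i. pl (Q i)))"
  have "?B u \<in> HSP ar (pl ` S)" if "u \<in> beta I" for u
  proof -
    have U: "ultrafilter_on I (elts ` elts u)"
      using that by (simp add: beta_def)
    then obtain P where "P \<in> S" "embeds ar (?B u) (pl P)"
      using sig_alg_uprod_embeds[OF I U Q S] by blast
    moreover have "algebra ar (?B u)"
      using variety_alg_uprod[OF variety I U QC] sig_closed variety_algebra[OF variety] by blast
    ultimately show ?thesis
      using HSP_superset[OF K] by (blast intro: variety_embeds[OF variety_HSP])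
  qed
  then have "alg_prod ar (beta I) ?B \<in> HSP ar (pl ` S)"
    by (intro variety_alg_prod[OF variety_HSP] small_beta I) blast
  moreover have "embeds ar (sig (alg_prod ar I (\<lambda>i. pl (Q i)))) (alg_prod ar (beta I) ?B)"
    using Q S by (intro A4 I) auto
  moreover have "algebra ar (sig (alg_prod ar I (\<lambda>i. pl (Q i))))"
    using variety_alg_prod[OF variety I QC] sig_closed variety_algebra[OF variety] by blast
  ultimately show ?thesis
    by (rule variety_embeds[OF variety_HSP])
qed

lemma sig_in_HSP:
  assumes S: "S \<subseteq> \<Sigma>" "Defs.uprod_closed \<tau> S" and A: "A \<in> HSP ar (pl ` S)"
  shows "sig A \<in> HSP ar (pl ` S)"
proof -
  have KC: "pl ` S \<subseteq> C"
    using S pl_closed by blast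
  from A obtain I B D where I: "small I" and B: "\<forall>i\<in>I. B i \<in> pl ` S"
    and D: "algebra ar D" "embeds ar D (alg_prod ar I B)" "maps_onto ar D A"
    unfolding HSP_iff by blast
  from B have "\<forall>i\<in>I. \<exists>P. P \<in> S \<and> B i = pl P"
    by blast
  then obtain Q where Q: "\<forall>i\<in>I. Q i \<in> S" "\<And>i. i \<in> I \<Longrightarrow> B i = pl (Q i)"
    by metis
  \<comment> \<open>(A1) requires the product, \<open>D\<close> and \<open>A\<close> to lie in
    \<open>C\<close>; all three do because \<open>C\<close> is a variety containing the image of
    \<open>S\<close> under \<open>pl\<close>.\<close>
  have PC: "alg_prod ar I B \<in> C"
    using B KC by (intro variety_alg_prod[OF variety I]) auto
  have DC: "D \<in> C"
    using variety_embeds[OF variety PC D(2,1)] .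
  have AC: "A \<in> C"
    using A HSP_least[OF variety KC] by blast
  have sig_alg: "algebra ar (sig E)" if "E \<in> C" for E
    using that sig_closed variety_algebra[OF variety] by blast
  \<comment> \<open>\<open>sig\<close> acts on records, so the two products must be literally equal;
    agreement of \<open>B i\<close> with \<open>pl (Q i)\<close> on \<open>I\<close> is enough for
    that.\<close>
  have "sig (alg_prod ar I B) \<in> HSP ar (pl ` S)"
    using sig_alg_prod_in_HSP[OF I Q(1) S] Q(2) by (simp cong: alg_prod_cong)
  then have "sig D \<in> HSP ar (pl ` S)"
    using A1_embeds[OF DC PC D(2)] sig_alg[OF DC] by (rule variety_embeds[OF variety_HSP])
  then show ?thesis
    using A1_onto[OF DC AC D(3)] sig_alg[OF AC] by (rule variety_maps_onto[OF variety_HSP])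
qed

end

theorem theorem7p1:
  fixes \<tau> :: "('s, 'g, 'r) sim_type"
    and ar :: "'f \<Rightarrow> nat option"
    and \<Sigma> :: "('s, 'g, 'r, 'v::set_universe) struct set"
    and C :: "('f, 'v) alg set"
    and sig :: "('f, 'v) alg \<Rightarrow> ('f, 'v) alg"
    and pl :: "('s, 'g, 'r, 'v) struct \<Rightarrow> ('f, 'v) alg"
    and S :: "('s, 'g, 'r, 'v) struct set"
  assumes "canonicity_framework \<tau> ar \<Sigma> C sig pl"
    and "S \<subseteq> \<Sigma>"
    and "uprod_closed \<tau> S"
  shows "variety_generated ar (pl ` S) = HSP ar (pl ` S) \<and>
    (\<forall>A \<in> variety_generated ar (pl ` S). sig A \<in> variety_generated ar (pl ` S))"
proof -
  interpret canonicity_framework \<tau> ar \<Sigma> C sig pl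
    by (rule assms(1))
  have "variety_generated ar (pl ` S) = HSP ar (pl ` S)"
    using assms(2) pl_closed variety_algebra[OF variety]
    by (intro variety_generated_eq_HSP) blast
  then show ?thesis
    using sig_in_HSP[OF assms(2,3)] by simp
qed

end
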